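(* Let $R$ be a left artinian ring. For any left ideal $I$ of $R$, the left ideal $\sqrt[\mathrm{j}]{I}$ is fully integral over $I$. In particular, $\sqrt[\mathrm{f}]{I}=\sqrt[\mathrm{i}]{I}=\sqrt[\mathrm{j}]{I}$.
   Context: Rings are associative and unital, not necessarily commutative. Let $I$ be a left ideal of $R$. The Jacobson radical $\sqrt[\mathrm{j}]{I}$ of $I$ is the intersection of all maximal left ideals of $R$ containing $I$ (so it is $R$ when $I=R$). An element $a\in R$ is integral over $I$ if there exist $n\ge1$ and $r_0,\dots,r_{n-1}\in I$ with $a^n+r_{n-1}a^{n-1}+\cdots+r_1a+r_0=0$; a subset of $R$ is integral over $I$ if each of its elements is. For $b_1,\dots,b_k\in R$, $Ib_1\cdots b_k=\{rb_1\cdots b_k\mid r\in I\}$ (equal to $I$ when $k=0$). A subset $A\subseteq R$ is fully integral over $I$ if there exists $n\ge 1$ such that for all $a_1,\dots,a_n\in A$, $a_1\cdots a_n\in \sum_{k=0}^{n-1}\sum_{1\le i_1,\dots,i_k\le n} I a_{i_1}\cdots a_{i_k}$. A left ideal $J$ is integrally closed (resp. fully integrally closed) if no left ideal of $R$ properly containing $J$ is integral (resp. fully integral) over $J$. The integral radical $\sqrt[\mathrm{i}]{I}$ (resp. full integral radical $\sqrt[\mathrm{f}]{I}$) is the intersection of all integrally closed (resp. fully integrally closed) left ideals of $R$ containing $I$. *)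

theory Defs
  imports "HOL-Algebra.Ideal"
begin

locale left_ideal = additive_subgroup I R + ring R for I and R (structure) +
  assumes l_closed: "\<lbrakk>a \<in> I; x \<in> carrier R\<rbrakk> \<Longrightarrow> x \<otimes> a \<in> I"

locale maximal_left_ideal = left_ideal +
  assumes notcarr: "carrier R \<noteq> I"
    and maximal: "\<lbrakk>left_ideal J R; I \<subseteq> J\<rbrakk> \<Longrightarrow> J = I \<or> J = carrier R"

locale left_artinian_ring = ring +
  assumes descending_chain:
    "\<lbrakk>\<And>n::nat. left_ideal (C n) R; \<And>n. C (Suc n) \<subseteq> C n\<rbrakk> \<Longrightarrow> \<exists>N. \<forall>n\<ge>N. C n = C N"

text \<open>Intersecting with the carrier gives the value \<open>carrier R\<close> when no maximal left ideal
  contains \<open>I\<close>.\<close>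

definition jacobson_radical :: "('a, 'b) ring_scheme \<Rightarrow> 'a set \<Rightarrow> 'a set" where
  "jacobson_radical R I = carrier R \<inter> \<Inter>{M. maximal_left_ideal M R \<and> I \<subseteq> M}"

definition integral_elem :: "('a, 'b) ring_scheme \<Rightarrow> 'a set \<Rightarrow> 'a \<Rightarrow> bool" where
  "integral_elem R I a \<longleftrightarrow> a \<in> carrier R \<and>
     (\<exists>n\<ge>1. \<exists>r\<in>{..<n} \<rightarrow> I.
        a [^]\<^bsub>R\<^esub> (n::nat) \<oplus>\<^bsub>R\<^esub> (\<Oplus>\<^bsub>R\<^esub>k\<in>{..<n}. r k \<otimes>\<^bsub>R\<^esub> a [^]\<^bsub>R\<^esub> k) = \<zero>\<^bsub>R\<^esub>)"

definition integral_over :: "('a, 'b) ring_scheme \<Rightarrow> 'a set \<Rightarrow> 'a set \<Rightarrow> bool" where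
  "integral_over R I A \<longleftrightarrow> (\<forall>a\<in>A. integral_elem R I a)"

definition list_prod :: "('a, 'b) ring_scheme \<Rightarrow> 'a list \<Rightarrow> 'a" where
  "list_prod R bs = foldr (\<otimes>\<^bsub>R\<^esub>) bs \<one>\<^bsub>R\<^esub>"

definition index_words :: "nat \<Rightarrow> nat list set" where
  "index_words n = {w. set w \<subseteq> {1..n} \<and> length w < n}"

text \<open>An element of the sum of the sets \<open>I a\<^sub>i\<^sub>1 \<dots> a\<^sub>i\<^sub>k\<close>, one for each word \<open>i\<^sub>1 \<dots> i\<^sub>k\<close> of length
  \<open>k < n\<close> over \<open>{1..n}\<close>, is given by a choice of one coefficient in \<open>I\<close> per word; the empty word
  contributes the summand \<open>I\<close>.\<close>

definition word_sum :: "('a, 'b) ring_scheme \<Rightarrow> 'a set \<Rightarrow> nat \<Rightarrow> (nat \<Rightarrow> 'a) \<Rightarrow> 'a set" where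
  "word_sum R I n a =
     {\<Oplus>\<^bsub>R\<^esub>w\<in>index_words n. r w \<otimes>\<^bsub>R\<^esub> list_prod R (map a w) | r. r \<in> index_words n \<rightarrow> I}"

definition fully_integral_over :: "('a, 'b) ring_scheme \<Rightarrow> 'a set \<Rightarrow> 'a set \<Rightarrow> bool" where
  "fully_integral_over R I A \<longleftrightarrow> A \<subseteq> carrier R \<and>
     (\<exists>n\<ge>1. \<forall>a\<in>{1..n} \<rightarrow> A. list_prod R (map a [1..<Suc n]) \<in> word_sum R I n a)"

definition integrally_closed :: "('a, 'b) ring_scheme \<Rightarrow> 'a set \<Rightarrow> bool" where
  "integrally_closed R J \<longleftrightarrow> left_ideal J R \<and>
     \<not> (\<exists>K. left_ideal K R \<and> J \<subset> K \<and> integral_over R J K)"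

definition fully_integrally_closed :: "('a, 'b) ring_scheme \<Rightarrow> 'a set \<Rightarrow> bool" where
  "fully_integrally_closed R J \<longleftrightarrow> left_ideal J R \<and>
     \<not> (\<exists>K. left_ideal K R \<and> J \<subset> K \<and> fully_integral_over R J K)"

text \<open>No intersection with the carrier is needed in the next two definitions: \<open>carrier R\<close> has no
  proper extension, so it is (fully) integrally closed and belongs to the intersected family.\<close>

definition integral_radical :: "('a, 'b) ring_scheme \<Rightarrow> 'a set \<Rightarrow> 'a set" where
  "integral_radical R I = \<Inter>{J. integrally_closed R J \<and> I \<subseteq> J}"

definition full_integral_radical :: "('a, 'b) ring_scheme \<Rightarrow> 'a set \<Rightarrow> 'a set" where
  "full_integral_radical R I = \<Inter>{J. fully_integrally_closed R J \<and> I \<subseteq> J}"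

end

theory Submission
  imports Defs
begin

text \<open>
  Write \<open>J\<close> for the Jacobson radical of the left ideal \<open>I\<close> and \<open>N\<close> for that of the zero ideal.
  The proof has three ingredients.

  \<^item> Over a left artinian ring \<open>J \<subseteq> I + N\<close>. In the semisimple quotient by \<open>N\<close> the image of \<open>I\<close> has
    a complement; upstairs, this is a left ideal \<open>P\<close> that is minimal subject to \<open>P + I = R\<close>, and the
    part of \<open>P\<close> inside \<open>J\<close> lies in \<open>N\<close> (\<open>jacobson_radical_decomposition\<close>).

  \<^item> \<open>N\<close> is nilpotent: some \<open>n\<close> kills all products of \<open>n\<close> elements of \<open>N\<close>
    (\<open>jacobson_radical_nilpotent\<close>).

  \<^item> If \<open>a\<^sub>i = x\<^sub>i + y\<^sub>i\<close> with \<open>x\<^sub>i \<in> I\<close> and \<open>y\<^sub>i \<in> N\<close>, then replacing the factors by \<open>y\<^sub>i\<close> one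
    after the other from the left gives
    \<open>a\<^sub>1 \<dots> a\<^sub>n = y\<^sub>1 \<dots> y\<^sub>n + \<Sum>\<^sub>k (y\<^sub>1 \<dots> y\<^sub>k x\<^sub>k\<^sub>+\<^sub>1) a\<^sub>k\<^sub>+\<^sub>2 \<dots> a\<^sub>n\<close>.
    Each bracket lies in the left ideal \<open>I\<close>, and the first summand vanishes, so this is an equation of
    full integrality over \<open>I\<close> (\<open>fully_integral_of_nilpotent_decomposition\<close>).

  Hence \<open>J\<close> is fully integral over \<open>I\<close>. A fully integrally closed left ideal is therefore its own
  Jacobson radical, which bounds the full integral radical from below by \<open>J\<close>. Full integrality implies
  integrality, so the full integral radical lies in the integral radical. Finally a maximal left ideal
  is integrally closed, since an integral equation for \<open>1\<close> over it would put \<open>1\<close> into it; so the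
  integral radical lies in \<open>J\<close>, and the three radicals agree.
\<close>

section \<open>Left ideals\<close>

lemma left_idealD:
  assumes "left_ideal L R"
  shows left_ideal_subset: "L \<subseteq> carrier R"
    and left_ideal_zero: "\<zero>\<^bsub>R\<^esub> \<in> L"
    and left_ideal_add: "\<And>x y. x \<in> L \<Longrightarrow> y \<in> L \<Longrightarrow> x \<oplus>\<^bsub>R\<^esub> y \<in> L"
    and left_ideal_minus: "\<And>x. x \<in> L \<Longrightarrow> \<ominus>\<^bsub>R\<^esub> x \<in> L"
    and left_ideal_mult: "\<And>r x. r \<in> carrier R \<Longrightarrow> x \<in> L \<Longrightarrow> r \<otimes>\<^bsub>R\<^esub> x \<in> L"
proof -
  interpret left_ideal L R by fact
  show "L \<subseteq> carrier R" by (rule a_subset)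
  show "\<zero>\<^bsub>R\<^esub> \<in> L" by simp
  show "x \<oplus>\<^bsub>R\<^esub> y \<in> L" if "x \<in> L" "y \<in> L" for x y using that by simp
  show "\<ominus>\<^bsub>R\<^esub> x \<in> L" if "x \<in> L" for x using that by simp
  show "r \<otimes>\<^bsub>R\<^esub> x \<in> L" if "r \<in> carrier R" "x \<in> L" for r x using that by (simp add: l_closed)
qed

context ring
begin

lemma left_idealI:
  assumes sub: "L \<subseteq> carrier R" and zero: "\<zero> \<in> L"
    and add: "\<And>x y. x \<in> L \<Longrightarrow> y \<in> L \<Longrightarrow> x \<oplus> y \<in> L"
    and mult: "\<And>r x. r \<in> carrier R \<Longrightarrow> x \<in> L \<Longrightarrow> r \<otimes> x \<in> L"
  shows "left_ideal L R"
proof -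
  have minus: "\<ominus> x \<in> L" if "x \<in> L" for x
    using mult[of "\<ominus> \<one>" x] that sub by (auto simp: l_minus)
  have "subgroup L (add_monoid R)"
    by (rule add.subgroupI) (use sub zero in \<open>auto intro: add minus\<close>)
  then show ?thesis
    by (intro left_ideal.intro additive_subgroup.intro left_ideal_axioms.intro ring_axioms)
      (auto intro: mult)
qed

lemma left_ideal_carrier: "left_ideal (carrier R) R"
  by (rule left_idealI) auto

lemma left_ideal_trivial: "left_ideal {\<zero>} R"
  by (rule left_idealI) auto

lemma left_ideal_Int:
  assumes "left_ideal K R" "left_ideal L R"
  shows "left_ideal (K \<inter> L) R"
  by (rule left_idealI)
    (use left_idealD[OF assms(1)] left_idealD[OF assms(2)] in auto)

lemma left_ideal_Inter:
  assumes "\<And>L. L \<in> \<F> \<Longrightarrow> left_ideal L R"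
  shows "left_ideal (carrier R \<inter> \<Inter>\<F>) R"
  by (rule left_idealI) (auto dest: assms intro: left_ideal_zero left_ideal_add left_ideal_mult)

lemma mem_set_addI: "h \<in> H \<Longrightarrow> k \<in> K \<Longrightarrow> h \<oplus> k \<in> H <+>\<^bsub>R\<^esub> K"
  unfolding set_add_def' by blast

lemma mem_set_addE:
  assumes "x \<in> H <+>\<^bsub>R\<^esub> K"
  obtains h k where "h \<in> H" "k \<in> K" "x = h \<oplus> k"
  using assms unfolding set_add_def' by blast

lemma left_ideal_set_add:
  assumes K: "left_ideal K R" and L: "left_ideal L R"
  shows "left_ideal (K <+>\<^bsub>R\<^esub> L) R"
proof (rule left_idealI)
  note K' = left_idealD[OF K] and L' = left_idealD[OF L]
  show "K <+>\<^bsub>R\<^esub> L \<subseteq> carrier R" using K'(1) L'(1) by (rule set_add_closed)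
  show "\<zero> \<in> K <+>\<^bsub>R\<^esub> L" using mem_set_addI[OF K'(2) L'(2)] by simp
  show "x \<oplus> y \<in> K <+>\<^bsub>R\<^esub> L" if "x \<in> K <+>\<^bsub>R\<^esub> L" "y \<in> K <+>\<^bsub>R\<^esub> L" for x y
  proof -
    from that obtain k l k' l' where *: "k \<in> K" "l \<in> L" "k' \<in> K" "l' \<in> L"
      "x = k \<oplus> l" "y = k' \<oplus> l'" by (elim mem_set_addE) blast
    then have c: "k \<in> carrier R" "l \<in> carrier R" "k' \<in> carrier R" "l' \<in> carrier R"
      using K'(1) L'(1) by auto
    have "x \<oplus> y = (k \<oplus> k') \<oplus> (l \<oplus> l')" using * c by (simp add: a_ac)
    then show ?thesis using mem_set_addI[OF K'(3)[OF *(1,3)] L'(3)[OF *(2,4)]] by simp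
  qed
  show "r \<otimes> x \<in> K <+>\<^bsub>R\<^esub> L" if r: "r \<in> carrier R" and "x \<in> K <+>\<^bsub>R\<^esub> L" for r x
  proof -
    from that(2) obtain k l where *: "k \<in> K" "l \<in> L" "x = k \<oplus> l" by (rule mem_set_addE)
    then have "k \<in> carrier R" "l \<in> carrier R" using K'(1) L'(1) by auto
    then have "r \<otimes> x = r \<otimes> k \<oplus> r \<otimes> l" using r *(3) by (simp add: r_distr)
    then show ?thesis using mem_set_addI[OF K'(5)[OF r *(1)] L'(5)[OF r *(2)]] by simp
  qed
qed

lemma left_subset_set_add:
  assumes "left_ideal K R" "left_ideal L R"
  shows "K \<subseteq> K <+>\<^bsub>R\<^esub> L" and "L \<subseteq> K <+>\<^bsub>R\<^esub> L"
proof -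
  note K' = left_idealD[OF assms(1)] and L' = left_idealD[OF assms(2)]
  show "K \<subseteq> K <+>\<^bsub>R\<^esub> L"
  proof
    fix x assume "x \<in> K"
    then have "x = x \<oplus> \<zero>" using K'(1) by auto
    then show "x \<in> K <+>\<^bsub>R\<^esub> L" using mem_set_addI[OF \<open>x \<in> K\<close> L'(2)] by simp
  qed
  show "L \<subseteq> K <+>\<^bsub>R\<^esub> L"
  proof
    fix x assume "x \<in> L"
    then have "x = \<zero> \<oplus> x" using L'(1) by auto
    then show "x \<in> K <+>\<^bsub>R\<^esub> L" using mem_set_addI[OF K'(2) \<open>x \<in> L\<close>] by simp
  qed
qed

lemma set_add_subset_left_ideal:
  assumes "left_ideal T R" "K \<subseteq> T" "L \<subseteq> T"
  shows "K <+>\<^bsub>R\<^esub> L \<subseteq> T"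
proof
  fix x assume "x \<in> K <+>\<^bsub>R\<^esub> L"
  then obtain k l where "k \<in> K" "l \<in> L" "x = k \<oplus> l" by (rule mem_set_addE)
  then show "x \<in> T" using left_ideal_add[OF assms(1), of k l] assms(2,3) by blast
qed

lemma left_ideal_times_elem:
  assumes B: "left_ideal B R" and x: "x \<in> carrier R"
  shows "left_ideal ((\<lambda>b. b \<otimes> x) ` B) R"
proof (rule left_idealI)
  note B' = left_idealD[OF B]
  show "(\<lambda>b. b \<otimes> x) ` B \<subseteq> carrier R" using B'(1) x by auto
  show "\<zero> \<in> (\<lambda>b. b \<otimes> x) ` B" using B'(2) x by force
  show "u \<oplus> v \<in> (\<lambda>b. b \<otimes> x) ` B" if "u \<in> (\<lambda>b. b \<otimes> x) ` B" "v \<in> (\<lambda>b. b \<otimes> x) ` B" for u v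
  proof -
    from that obtain b c where *: "b \<in> B" "c \<in> B" "u = b \<otimes> x" "v = c \<otimes> x" by auto
    then have "u \<oplus> v = (b \<oplus> c) \<otimes> x" using B'(1) x by (simp add: l_distr subset_iff)
    then show ?thesis using * B'(3) by blast
  qed
  show "r \<otimes> u \<in> (\<lambda>b. b \<otimes> x) ` B" if r: "r \<in> carrier R" and "u \<in> (\<lambda>b. b \<otimes> x) ` B" for r u
  proof -
    from that obtain b where *: "b \<in> B" "u = b \<otimes> x" by auto
    then have "r \<otimes> u = (r \<otimes> b) \<otimes> x" using B'(1) x r by (auto simp: m_assoc)
    then show ?thesis using * r B'(5) by blast
  qed
qed

lemma left_ideal_annihilator:
  assumes x: "x \<in> carrier R"
  shows "left_ideal {r \<in> carrier R. r \<otimes> x = \<zero>} R"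
  by (rule left_idealI) (use x in \<open>auto simp: l_distr m_assoc\<close>)

lemma left_ideal_eq_carrier_of_one:
  assumes "left_ideal L R" "\<one> \<in> L"
  shows "L = carrier R"
proof
  show "L \<subseteq> carrier R" using assms(1) by (rule left_ideal_subset)
  show "carrier R \<subseteq> L"
    using left_ideal_mult[OF assms(1) _ assms(2)] by fastforce
qed

definition left_span :: "'a set \<Rightarrow> 'a set" where
  "left_span S = carrier R \<inter> \<Inter>{L. left_ideal L R \<and> S \<subseteq> L}"

lemma left_ideal_left_span: "left_ideal (left_span S) R"
  unfolding left_span_def by (rule left_ideal_Inter) auto

lemma left_span_superset: "S \<subseteq> carrier R \<Longrightarrow> S \<subseteq> left_span S"
  unfolding left_span_def by auto

lemma left_span_subset: "left_ideal L R \<Longrightarrow> S \<subseteq> L \<Longrightarrow> left_span S \<subseteq> L"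
  unfolding left_span_def by auto

lemma maximal_left_idealD:
  assumes "maximal_left_ideal M R"
  shows "left_ideal M R" and "M \<noteq> carrier R"
    and "\<And>K. left_ideal K R \<Longrightarrow> M \<subseteq> K \<Longrightarrow> K = M \<or> K = carrier R"
  using maximal_left_ideal.axioms(1)[OF assms] maximal_left_ideal.notcarr[OF assms]
    maximal_left_ideal.maximal[OF assms] by auto

lemma one_notin_maximal_left_ideal:
  assumes "maximal_left_ideal M R"
  shows "\<one> \<notin> M"
  using maximal_left_idealD[OF assms] left_ideal_eq_carrier_of_one by blast

text \<open>Zorn's lemma, applied to the left ideals above \<open>L\<close> that miss \<open>1\<close>: this condition survives
  unions of chains.\<close>

lemma exists_maximal_left_ideal:
  assumes L: "left_ideal L R" and proper: "L \<noteq> carrier R"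
  shows "\<exists>M. maximal_left_ideal M R \<and> L \<subseteq> M"
proof -
  define \<A> where "\<A> = {K. left_ideal K R \<and> L \<subseteq> K \<and> \<one> \<notin> K}"
  have "L \<in> \<A>" using L proper left_ideal_eq_carrier_of_one unfolding \<A>_def by auto
  have "\<exists>M\<in>\<A>. \<forall>X\<in>\<A>. M \<subseteq> X \<longrightarrow> X = M"
  proof (rule subset_Zorn_nonempty)
    show "\<A> \<noteq> {}" using \<open>L \<in> \<A>\<close> by auto
    fix \<C> assume ne: "\<C> \<noteq> {}" and ch: "subset.chain \<A> \<C>"
    have sub: "\<C> \<subseteq> \<A>" and tot: "\<And>X Y. X \<in> \<C> \<Longrightarrow> Y \<in> \<C> \<Longrightarrow> X \<subseteq> Y \<or> Y \<subseteq> X"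
      using ch unfolding subset.chain_def by auto
    have li: "left_ideal K R" if "K \<in> \<C>" for K using that sub unfolding \<A>_def by auto
    have "left_ideal (\<Union>\<C>) R"
    proof (rule left_idealI)
      show "\<Union>\<C> \<subseteq> carrier R" using li left_ideal_subset by blast
      show "\<zero> \<in> \<Union>\<C>" using li left_ideal_zero ne by blast
      show "x \<oplus> y \<in> \<Union>\<C>" if xy: "x \<in> \<Union>\<C>" "y \<in> \<Union>\<C>" for x y
      proof -
        from xy obtain X Y where *: "X \<in> \<C>" "Y \<in> \<C>" "x \<in> X" "y \<in> Y" by auto
        with tot obtain Z where "Z \<in> \<C>" "x \<in> Z" "y \<in> Z" by blast
        then show ?thesis using left_ideal_add[OF li] by blast
      qed
      show "r \<otimes> x \<in> \<Union>\<C>" if "r \<in> carrier R" "x \<in> \<Union>\<C>" for r x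
        using that left_ideal_mult[OF li] by blast
    qed
    then show "\<Union>\<C> \<in> \<A>" using sub ne unfolding \<A>_def by blast
  qed
  then obtain M where M: "M \<in> \<A>" and max: "\<And>X. X \<in> \<A> \<Longrightarrow> M \<subseteq> X \<Longrightarrow> X = M" by blast
  have "maximal_left_ideal M R"
  proof (intro maximal_left_ideal.intro maximal_left_ideal_axioms.intro)
    show "left_ideal M R" using M unfolding \<A>_def by auto
    show "carrier R \<noteq> M" using M unfolding \<A>_def by auto
    fix K assume K: "left_ideal K R" "M \<subseteq> K"
    show "K = M \<or> K = carrier R"
    proof (cases "\<one> \<in> K")
      case True
      then show ?thesis using left_ideal_eq_carrier_of_one K by blast
    next
      case False
      then have "K \<in> \<A>" using K M unfolding \<A>_def by auto
      then show ?thesis using max K by blast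
    qed
  qed
  then show ?thesis using M unfolding \<A>_def by auto
qed

section \<open>The Jacobson radical\<close>

lemma left_ideal_jacobson_radical: "left_ideal (jacobson_radical R I) R"
  unfolding jacobson_radical_def
  by (rule left_ideal_Inter) (auto dest: maximal_left_idealD)

lemma subset_jacobson_radical: "I \<subseteq> carrier R \<Longrightarrow> I \<subseteq> jacobson_radical R I"
  unfolding jacobson_radical_def by auto

lemma jacobson_radical_mono: "I \<subseteq> K \<Longrightarrow> jacobson_radical R I \<subseteq> jacobson_radical R K"
  unfolding jacobson_radical_def by auto

lemma jacobson_radical_zeroI:
  assumes "x \<in> carrier R" "\<And>M. maximal_left_ideal M R \<Longrightarrow> x \<in> M"
  shows "x \<in> jacobson_radical R {\<zero>}"
  using assms unfolding jacobson_radical_def by auto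

lemma jacobson_radical_zeroD:
  assumes "x \<in> jacobson_radical R {\<zero>}" "maximal_left_ideal M R"
  shows "x \<in> M"
  using assms left_ideal_zero[OF maximal_left_idealD(1)] unfolding jacobson_radical_def by auto

text \<open>A form of Nakayama's lemma: \<open>1 - c\<close> annihilates \<open>x\<close> but lies in no maximal left ideal, so the
  annihilator of \<open>x\<close> is the whole ring.\<close>

lemma eq_zero_of_jacobson_fixed:
  assumes c: "c \<in> jacobson_radical R {\<zero>}" and x: "x \<in> carrier R" and fixed: "x = c \<otimes> x"
  shows "x = \<zero>"
proof -
  let ?A = "{r \<in> carrier R. r \<otimes> x = \<zero>}"
  have A: "left_ideal ?A R" using x by (rule left_ideal_annihilator)
  have cc: "c \<in> carrier R" using c unfolding jacobson_radical_def by auto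
  have "(\<one> \<oplus> \<ominus> c) \<otimes> x = x \<oplus> \<ominus> (c \<otimes> x)" using x cc by (simp add: l_distr l_minus)
  also have "\<dots> = \<zero>" using x fixed by (simp add: r_neg)
  finally have d: "\<one> \<oplus> \<ominus> c \<in> ?A" using cc by simp
  have "?A = carrier R"
  proof (rule ccontr)
    assume "?A \<noteq> carrier R"
    then obtain M where M: "maximal_left_ideal M R" "?A \<subseteq> M"
      using exists_maximal_left_ideal A by blast
    have "c \<in> M" using c M(1) by (rule jacobson_radical_zeroD)
    then have "(\<one> \<oplus> \<ominus> c) \<oplus> c \<in> M"
      using d M left_ideal_add[OF maximal_left_idealD(1)] by blast
    then have "\<one> \<in> M" using cc by (simp add: a_assoc l_neg)
    then show False using one_notin_maximal_left_ideal M(1) by blast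
  qed
  then have "\<one> \<in> ?A" using one_closed by blast
  then show ?thesis using x by simp
qed

text \<open>The quotient of \<open>P\<close> by \<open>P \<inter> M\<close> embeds into the simple module \<open>R / M\<close>, so anything in \<open>P\<close>
  outside \<open>M\<close> generates \<open>P\<close> together with \<open>P \<inter> M\<close>.\<close>

lemma subset_of_Int_maximal_subset:
  assumes M: "maximal_left_ideal M R" and P: "left_ideal P R" and K: "left_ideal K R"
    and sub: "P \<inter> M \<subseteq> K" and q: "q \<in> P" "q \<in> K" "q \<notin> M"
  shows "P \<subseteq> K"
proof
  note M' = left_idealD[OF maximal_left_idealD(1)[OF M]]
    and P' = left_idealD[OF P] and K' = left_idealD[OF K]
  have qc: "q \<in> carrier R" using q P'(1) by auto
  let ?Rq = "(\<lambda>r. r \<otimes> q) ` carrier R"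
  have Rq: "left_ideal ?Rq R" using left_ideal_carrier qc by (rule left_ideal_times_elem)
  have "q = \<one> \<otimes> q" using qc by simp
  then have "q \<in> ?Rq" by blast
  note sum = left_ideal_set_add[OF maximal_left_idealD(1)[OF M] Rq]
    left_subset_set_add[OF maximal_left_idealD(1)[OF M] Rq]
  have top: "M <+>\<^bsub>R\<^esub> ?Rq = carrier R"
    using maximal_left_idealD(3)[OF M sum(1,2)] sum(3) \<open>q \<in> ?Rq\<close> q(3) by blast
  fix p assume p: "p \<in> P"
  then have "p \<in> M <+>\<^bsub>R\<^esub> ?Rq" unfolding top using P'(1) by auto
  then obtain m r where mr: "m \<in> M" "r \<in> carrier R" "p = m \<oplus> r \<otimes> q"
    by (auto elim: mem_set_addE)
  have mc: "m \<in> carrier R" using mr M'(1) by auto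
  have "p \<oplus> \<ominus> (r \<otimes> q) = m" using mr mc qc by (simp add: a_assoc r_neg)
  moreover have "p \<oplus> \<ominus> (r \<otimes> q) \<in> P" using p q mr P' by simp
  ultimately have "m \<in> K" using sub mr by auto
  then show "p \<in> K" using mr q K' by simp
qed

section \<open>Products and coefficient sums\<close>

lemma list_prod_simps [simp]:
  "list_prod R [] = \<one>" "list_prod R (x # xs) = x \<otimes> list_prod R xs"
  unfolding list_prod_def by simp_all

lemma list_prod_closed: "set xs \<subseteq> carrier R \<Longrightarrow> list_prod R xs \<in> carrier R"
  by (induction xs) auto

lemma list_prod_append:
  "set xs \<subseteq> carrier R \<Longrightarrow> set ys \<subseteq> carrier R \<Longrightarrow>
    list_prod R (xs @ ys) = list_prod R xs \<otimes> list_prod R ys"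
  by (induction xs) (auto simp: list_prod_closed m_assoc)

lemma list_prod_in_left_ideal:
  assumes "left_ideal L R"
  shows "set xs \<subseteq> L \<Longrightarrow> xs \<noteq> [] \<Longrightarrow> list_prod R xs \<in> L"
proof (induction xs)
  case (Cons x xs)
  then have "x \<in> L" "x \<in> carrier R" using left_ideal_subset[OF assms] by auto
  then show ?case using Cons left_ideal_mult[OF assms] by (cases "xs = []") auto
qed simp

lemma list_prod_map_const:
  assumes "a \<in> carrier R"
  shows "list_prod R (map (\<lambda>_. a) w) = a [^] length w"
proof (induction w)
  case (Cons i w)
  then have "list_prod R (map (\<lambda>_. a) (i # w)) = a \<otimes> a [^] length w" by simp
  also have "\<dots> = a [^] Suc (length w)" using assms by (rule nat_pow_Suc2[symmetric])
  finally show ?case by simp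
qed simp

text \<open>Both notions of integrality ask for membership in a set of this kind, indexed by words and by
  exponents respectively.\<close>

definition coefficient_sums :: "'a set \<Rightarrow> 'i set \<Rightarrow> ('i \<Rightarrow> 'a) \<Rightarrow> 'a set" where
  "coefficient_sums I W f = {\<Oplus>w\<in>W. r w \<otimes> f w | r. r \<in> W \<rightarrow> I}"

lemma left_ideal_coefficient_sums:
  assumes I: "left_ideal I R" and fin: "finite W" and f: "f \<in> W \<rightarrow> carrier R"
  shows "left_ideal (coefficient_sums I W f) R"
proof (rule left_idealI)
  note I' = left_idealD[OF I]
  have cl: "r w \<otimes> f w \<in> carrier R" "r w \<in> carrier R" "f w \<in> carrier R"
    if "r \<in> W \<rightarrow> I" "w \<in> W" for r w
    using that f I'(1) by auto
  show "coefficient_sums I W f \<subseteq> carrier R"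
    unfolding coefficient_sums_def using cl(1) by (auto intro!: finsum_closed)
  have "(\<Oplus>w\<in>W. \<zero> \<otimes> f w) = \<zero>"
    using f by (intro add.finprod_one_eqI) (auto simp: Pi_iff)
  then show "\<zero> \<in> coefficient_sums I W f"
    unfolding coefficient_sums_def using I'(2) by (intro CollectI exI[of _ "\<lambda>_. \<zero>"]) auto
  show "x \<oplus> y \<in> coefficient_sums I W f"
    if "x \<in> coefficient_sums I W f" "y \<in> coefficient_sums I W f" for x y
  proof -
    from that obtain r s where *: "r \<in> W \<rightarrow> I" "s \<in> W \<rightarrow> I"
      "x = (\<Oplus>w\<in>W. r w \<otimes> f w)" "y = (\<Oplus>w\<in>W. s w \<otimes> f w)"
      unfolding coefficient_sums_def by auto
    have "x \<oplus> y = (\<Oplus>w\<in>W. r w \<otimes> f w \<oplus> s w \<otimes> f w)"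
      using * cl(1) by (subst finsum_addf) auto
    also have "\<dots> = (\<Oplus>w\<in>W. (r w \<oplus> s w) \<otimes> f w)"
      by (rule finsum_cong') (use * cl in \<open>auto simp: l_distr\<close>)
    finally show ?thesis
      unfolding coefficient_sums_def using * I'(3)
      by (intro CollectI exI[of _ "\<lambda>w. r w \<oplus> s w"]) auto
  qed
  show "c \<otimes> x \<in> coefficient_sums I W f"
    if c: "c \<in> carrier R" and "x \<in> coefficient_sums I W f" for c x
  proof -
    from that obtain r where *: "r \<in> W \<rightarrow> I" "x = (\<Oplus>w\<in>W. r w \<otimes> f w)"
      unfolding coefficient_sums_def by auto
    have "c \<otimes> x = (\<Oplus>w\<in>W. c \<otimes> (r w \<otimes> f w))"
      unfolding *(2) by (rule finsum_rdistr) (use * c cl(1) fin in auto)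
    also have "\<dots> = (\<Oplus>w\<in>W. (c \<otimes> r w) \<otimes> f w)"
      by (rule finsum_cong') (use * c cl in \<open>auto simp: m_assoc\<close>)
    finally show ?thesis
      unfolding coefficient_sums_def using * c I'(5)
      by (intro CollectI exI[of _ "\<lambda>w. c \<otimes> r w"]) auto
  qed
qed

lemma coefficient_sums_single:
  assumes I: "left_ideal I R" and fin: "finite W" and f: "f \<in> W \<rightarrow> carrier R"
    and w: "w \<in> W" and x: "x \<in> I"
  shows "x \<otimes> f w \<in> coefficient_sums I W f"
proof -
  note I' = left_idealD[OF I]
  let ?r = "\<lambda>v. if w = v then x else \<zero>"
  have xc: "x \<in> carrier R" using x I'(1) by auto
  have fc: "f v \<in> carrier R" if "v \<in> W" for v using that f by auto
  have "(\<Oplus>v\<in>W. ?r v \<otimes> f v) = (\<Oplus>v\<in>W. if w = v then x \<otimes> f v else \<zero>)"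
    by (rule finsum_cong') (use fc xc in auto)
  also have "\<dots> = x \<otimes> f w"
    by (rule finsum_singleton) (use w fin fc xc in auto)
  finally have "x \<otimes> f w = (\<Oplus>v\<in>W. ?r v \<otimes> f v)" by simp
  moreover have "?r \<in> W \<rightarrow> I" using x I'(2) by auto
  ultimately show ?thesis unfolding coefficient_sums_def by (intro CollectI exI[of _ ?r]) simp
qed

lemma coefficient_sums_subset_left_ideal:
  fixes W :: "'i set"
  assumes L: "left_ideal L R" and fin: "finite W"
    and terms: "\<And>w x. w \<in> W \<Longrightarrow> x \<in> I \<Longrightarrow> x \<otimes> f w \<in> L"
  shows "coefficient_sums I W f \<subseteq> L"
proof -
  note L' = left_idealD[OF L]
  have "(\<Oplus>w\<in>W. g w) \<in> L" if "\<And>w. w \<in> W \<Longrightarrow> g w \<in> L" for g :: "'i \<Rightarrow> 'a"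
    using fin that
  proof (induction W)
    case (insert w W)
    have "g w \<in> carrier R" "g \<in> W \<rightarrow> carrier R" using insert L'(1) by auto
    then show ?case using insert L'(3) by simp
  qed (use L'(2) in simp)
  then show ?thesis unfolding coefficient_sums_def using terms by (auto simp: Pi_iff)
qed

section \<open>Integrality\<close>

lemma finite_index_words: "finite (index_words n)"
proof (rule finite_subset)
  show "index_words n \<subseteq> {w. set w \<subseteq> {1..n} \<and> length w \<le> n}"
    unfolding index_words_def by auto
  show "finite {w. set w \<subseteq> {1..n} \<and> length w \<le> n}"
    by (rule finite_lists_length_le) simp
qed

lemma word_sum_eq_coefficient_sums:
  "word_sum R I n a = coefficient_sums I (index_words n) (\<lambda>w. list_prod R (map a w))"
  unfolding word_sum_def coefficient_sums_def ..

lemma list_prod_index_words: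
  assumes "a \<in> {1..n} \<rightarrow> carrier R"
  shows "(\<lambda>w. list_prod R (map a w)) \<in> index_words n \<rightarrow> carrier R"
  using assms unfolding index_words_def by (auto simp: Pi_iff subset_iff intro!: list_prod_closed)

text \<open>Evaluating the condition of full integrality at the constant family \<open>a, \<dots>, a\<close> turns every word
  of length \<open>k\<close> into \<open>a\<^sup>k\<close>.\<close>

lemma integral_of_fully_integral:
  assumes I: "left_ideal I R" and full: "fully_integral_over R I A"
  shows "integral_over R I A"
  unfolding integral_over_def
proof
  fix a assume "a \<in> A"
  from full obtain n where A: "A \<subseteq> carrier R" and n: "n \<ge> 1"
    and eq: "\<And>b. b \<in> {1..n} \<rightarrow> A \<Longrightarrow> list_prod R (map b [1..<Suc n]) \<in> word_sum R I n b"
    unfolding fully_integral_over_def by auto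
  have a: "a \<in> carrier R" using A \<open>a \<in> A\<close> by auto
  let ?T = "coefficient_sums I {..<n} (\<lambda>k. a [^] k)"
  have T: "left_ideal ?T R" by (rule left_ideal_coefficient_sums[OF I]) (use a in auto)
  have "coefficient_sums I (index_words n) (\<lambda>w. list_prod R (map (\<lambda>_. a) w)) \<subseteq> ?T"
  proof (rule coefficient_sums_subset_left_ideal[OF T finite_index_words])
    fix w x assume "w \<in> index_words n" "x \<in> I"
    then show "x \<otimes> list_prod R (map (\<lambda>_. a) w) \<in> ?T"
      unfolding list_prod_map_const[OF a] index_words_def
      using coefficient_sums_single[OF I, of "{..<n}" "\<lambda>k. a [^] k"] a by auto
  qed
  moreover have "list_prod R (map (\<lambda>_. a) [1..<Suc n]) = a [^] n"
    by (subst list_prod_map_const[OF a]) (simp del: upt_Suc)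
  ultimately have "a [^] n \<in> ?T"
    using eq[of "\<lambda>_. a"] \<open>a \<in> A\<close> unfolding word_sum_eq_coefficient_sums by auto
  then have "\<ominus> (a [^] n) \<in> ?T" by (rule left_ideal_minus[OF T])
  then obtain r where r: "r \<in> {..<n} \<rightarrow> I" "\<ominus> (a [^] n) = (\<Oplus>k\<in>{..<n}. r k \<otimes> a [^] k)"
    unfolding coefficient_sums_def by auto
  have "a [^] n \<oplus> (\<Oplus>k\<in>{..<n}. r k \<otimes> a [^] k) = \<zero>"
    unfolding r(2)[symmetric] using a by (simp add: r_neg)
  then show "integral_elem R I a" unfolding integral_elem_def using a n r(1) by blast
qed

lemma fully_integrally_closed_of_integrally_closed:
  "integrally_closed R J \<Longrightarrow> fully_integrally_closed R J"
  unfolding integrally_closed_def fully_integrally_closed_def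
  using integral_of_fully_integral by blast

lemma one_mem_of_integral_one:
  assumes I: "left_ideal I R" and int: "integral_elem R I \<one>"
  shows "\<one> \<in> I"
proof -
  from int obtain n :: nat and r where r: "r \<in> {..<n} \<rightarrow> I"
    and eq: "\<one> [^] n \<oplus> (\<Oplus>k\<in>{..<n}. r k \<otimes> \<one> [^] k) = \<zero>"
    unfolding integral_elem_def by blast
  let ?s = "\<Oplus>k\<in>{..<n}. r k \<otimes> \<one> [^] k"
  have "coefficient_sums I {..<n} (\<lambda>k. \<one> [^] k) \<subseteq> I"
    by (rule coefficient_sums_subset_left_ideal[OF I]) (use left_ideal_subset[OF I] in auto)
  then have s: "?s \<in> I" using r unfolding coefficient_sums_def by blast
  have "\<one> = \<ominus> ?s"
    using eq s left_ideal_subset[OF I] by (intro minus_equality[symmetric]) auto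
  then show ?thesis using left_ideal_minus[OF I s] by simp
qed

lemma integrally_closed_maximal_left_ideal:
  assumes "maximal_left_ideal M R"
  shows "integrally_closed R M"
  unfolding integrally_closed_def
proof (intro conjI notI)
  show M: "left_ideal M R" using assms by (rule maximal_left_idealD)
  assume "\<exists>K. left_ideal K R \<and> M \<subset> K \<and> integral_over R M K"
  then obtain K where K: "left_ideal K R" "M \<subset> K" "integral_over R M K" by blast
  then have "K = carrier R" using maximal_left_idealD(3)[OF assms] by blast
  then have "integral_elem R M \<one>" using K(3) unfolding integral_over_def by blast
  then show False
    using one_mem_of_integral_one[OF M] one_notin_maximal_left_ideal[OF assms] by blast
qed

lemma integrally_closed_carrier: "integrally_closed R (carrier R)"
  unfolding integrally_closed_def using left_ideal_carrier left_ideal_subset by blast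

lemma integral_radical_subset_jacobson_radical:
  assumes "I \<subseteq> carrier R"
  shows "integral_radical R I \<subseteq> jacobson_radical R I"
  unfolding integral_radical_def jacobson_radical_def
  using integrally_closed_maximal_left_ideal integrally_closed_carrier assms by blast

lemma full_integral_radical_subset_integral_radical:
  "full_integral_radical R I \<subseteq> integral_radical R I"
  unfolding full_integral_radical_def integral_radical_def
  using fully_integrally_closed_of_integrally_closed by blast

text \<open>Modulo the word sum, the product \<open>a\<^sub>1 \<dots> a\<^sub>n\<close> does not change when its first \<open>k\<close> factors are
  replaced by their components in \<open>N\<close>. For \<open>k = n\<close> the new product is zero, and induction
  downwards on \<open>k\<close> leads back to \<open>a\<^sub>1 \<dots> a\<^sub>n\<close>.\<close>

lemma fully_integral_of_nilpotent_decomposition: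
  assumes I: "left_ideal I R" and N: "N \<subseteq> carrier R" and A: "A \<subseteq> I <+>\<^bsub>R\<^esub> N"
    and n: "n \<ge> 1"
    and nil: "\<And>ys. set ys \<subseteq> N \<Longrightarrow> length ys = n \<Longrightarrow> list_prod R ys = \<zero>"
  shows "fully_integral_over R I A"
  unfolding fully_integral_over_def
proof (intro conjI exI[of _ n] n ballI)
  have "I <+>\<^bsub>R\<^esub> N \<subseteq> carrier R" using left_ideal_subset[OF I] N by (rule set_add_closed)
  with A show Ac: "A \<subseteq> carrier R" by blast
  fix a assume "a \<in> {1..n} \<rightarrow> A"
  then have a: "a i \<in> A" if "i \<in> {1..n}" for i using that by auto
  then have "\<forall>i\<in>{1..n}. \<exists>x y. x \<in> I \<and> y \<in> N \<and> a i = x \<oplus> y"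
    using A by (blast elim: mem_set_addE)
  then obtain x y where xy: "\<And>i. i \<in> {1..n} \<Longrightarrow> x i \<in> I \<and> y i \<in> N \<and> a i = x i \<oplus> y i"
    by metis
  have ac: "a i \<in> carrier R" and xc: "x i \<in> carrier R" and yc: "y i \<in> carrier R"
    if "i \<in> {1..n}" for i
    using that a Ac xy N left_ideal_subset[OF I] by blast+
  let ?S = "word_sum R I n a"
  have S: "left_ideal ?S R"
    unfolding word_sum_eq_coefficient_sums
    by (intro left_ideal_coefficient_sums I finite_index_words list_prod_index_words) (use ac in auto)
  have "list_prod R (map y [1..<Suc k]) \<otimes> list_prod R (map a [Suc k..<Suc n]) \<in> ?S" if "k \<le> n" for k
    using that
  proof (induction k rule: inc_induct)
    case base
    have "list_prod R (map y [1..<Suc n]) = \<zero>"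
      by (rule nil) (use xy in auto)
    then show ?case using left_ideal_zero[OF S] by simp
  next
    case (step k)
    let ?p = "list_prod R (map y [1..<Suc k])" and ?t = "list_prod R (map a [Suc (Suc k)..<Suc n])"
      and ?i = "Suc k"
    have i: "?i \<in> {1..n}" using step by auto
    have p: "?p \<in> carrier R" by (rule list_prod_closed) (use yc step in auto)
    have t: "?t \<in> carrier R" by (rule list_prod_closed) (use ac step in auto)
    note c = p t xc[OF i] yc[OF i]
    have "list_prod R (map a [?i..<Suc n]) = a ?i \<otimes> ?t"
      using step by (simp add: upt_conv_Cons del: upt_Suc)
    then have "?p \<otimes> list_prod R (map a [?i..<Suc n]) = ?p \<otimes> ((x ?i \<oplus> y ?i) \<otimes> ?t)"
      using xy[OF i] by simp
    also have "\<dots> = (?p \<otimes> x ?i) \<otimes> ?t \<oplus> (?p \<otimes> y ?i) \<otimes> ?t"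
      using c by (simp add: l_distr r_distr m_assoc)
    also have "?p \<otimes> y ?i = list_prod R (map y [1..<Suc ?i])"
    proof -
      have "[1..<Suc ?i] = [1..<Suc k] @ [?i]" by simp
      moreover have "set (map y [1..<Suc k]) \<subseteq> carrier R" using yc step by auto
      ultimately show ?thesis
        using list_prod_append[of "map y [1..<Suc k]" "[y ?i]"] c by (simp del: upt_Suc)
    qed
    finally have eq: "?p \<otimes> list_prod R (map a [?i..<Suc n]) =
      (?p \<otimes> x ?i) \<otimes> ?t \<oplus> list_prod R (map y [1..<Suc ?i]) \<otimes> ?t" .
    have "?p \<otimes> x ?i \<in> I" using left_ideal_mult[OF I p] xy[OF i] by blast
    moreover have "[Suc (Suc k)..<Suc n] \<in> index_words n"
      using step unfolding index_words_def by auto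
    ultimately have "(?p \<otimes> x ?i) \<otimes> ?t \<in> ?S"
      unfolding word_sum_eq_coefficient_sums
      using coefficient_sums_single[OF I finite_index_words list_prod_index_words] ac
      by (metis (no_types, lifting) Pi_I')
    then show ?case unfolding eq using step.IH left_ideal_add[OF S] by blast
  qed
  from this[of 0] show "list_prod R (map a [1..<Suc n]) \<in> ?S"
    using list_prod_closed[of "map a [1..<Suc n]"] ac by (simp del: upt_Suc add: image_subset_iff)
qed

end

section \<open>Left artinian rings\<close>

context left_artinian_ring
begin

lemma exists_minimal_left_ideal:
  assumes li: "\<And>L. L \<in> \<F> \<Longrightarrow> left_ideal L R" and ne: "\<F> \<noteq> {}"
  shows "\<exists>L\<in>\<F>. \<forall>K\<in>\<F>. \<not> K \<subset> L"
proof (rule ccontr)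
  assume "\<not> ?thesis"
  then have step: "\<exists>K. K \<in> \<F> \<and> K \<subset> L" if "L \<in> \<F>" for L using that by blast
  have "\<exists>C. \<forall>n. C n \<in> \<F> \<and> C (Suc n) \<subset> C n"
    using ne step by (intro dependent_nat_choice[of "\<lambda>_ L. L \<in> \<F>" "\<lambda>_ L K. K \<subset> L"]) auto
  then obtain C where C: "\<And>n. C n \<in> \<F>" "\<And>n. C (Suc n) \<subset> C n" by blast
  then obtain m where "\<forall>n\<ge>m. C n = C m"
    using descending_chain[of C] li by blast
  then show False using C(2)[of m] by (metis le_SucI order_refl psubset_eq)
qed

text \<open>Choose \<open>P\<close> minimal subject to \<open>P + I = R\<close>. Let \<open>M\<close> be a maximal left ideal not containing
  \<open>P\<close>. An element of \<open>P \<inter> I\<close> outside \<open>M\<close> would make \<open>(P \<inter> M) + I\<close> the whole ring, against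
  minimality; so \<open>P \<inter> I \<subseteq> M\<close>. It follows that \<open>(P \<inter> M) + I\<close> is a maximal left ideal which meets \<open>P\<close>
  inside \<open>M\<close>; it contains \<open>I\<close>, hence also the Jacobson radical of \<open>I\<close>. So the elements of \<open>P\<close> in that
  radical belong to all maximal left ideals \<open>M\<close>.\<close>

lemma jacobson_radical_decomposition:
  assumes I: "left_ideal I R"
  shows "jacobson_radical R I \<subseteq> I <+>\<^bsub>R\<^esub> jacobson_radical R {\<zero>}"
proof
  note I' = left_idealD[OF I]
  let ?J = "jacobson_radical R I"
  note J' = left_idealD[OF left_ideal_jacobson_radical[of I]]
  have IJ: "I \<subseteq> ?J" using I'(1) by (rule subset_jacobson_radical)
  define \<F> where "\<F> = {P. left_ideal P R \<and> P <+>\<^bsub>R\<^esub> I = carrier R}"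
  have "carrier R <+>\<^bsub>R\<^esub> I = carrier R"
    using left_subset_set_add(1)[OF left_ideal_carrier I] set_add_closed[OF order_refl I'(1)] by blast
  then have "carrier R \<in> \<F>" unfolding \<F>_def using left_ideal_carrier by blast
  then have "\<exists>P\<in>\<F>. \<forall>K\<in>\<F>. \<not> K \<subset> P"
    by (intro exists_minimal_left_ideal) (auto simp: \<F>_def)
  then obtain P where "P \<in> \<F>" and minimal: "\<And>K. K \<in> \<F> \<Longrightarrow> \<not> K \<subset> P" by blast
  then have P: "left_ideal P R" and top: "P <+>\<^bsub>R\<^esub> I = carrier R" unfolding \<F>_def by auto
  note P' = left_idealD[OF P]
  have key: "p \<in> M" if p: "p \<in> P" "p \<in> ?J" and M: "maximal_left_ideal M R" for p M
  proof (cases "P \<subseteq> M")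
    case False
    note M' = left_idealD[OF maximal_left_idealD(1)[OF M]]
    define Q where "Q = (P \<inter> M) <+>\<^bsub>R\<^esub> I"
    have PM: "left_ideal (P \<inter> M) R" using P maximal_left_idealD(1)[OF M] by (rule left_ideal_Int)
    have Q: "left_ideal Q R" and PMQ: "P \<inter> M \<subseteq> Q" and IQ: "I \<subseteq> Q"
      unfolding Q_def using left_ideal_set_add left_subset_set_add PM I by blast+
    have fill: "K = carrier R"
      if K: "left_ideal K R" "Q \<subseteq> K" and q: "q \<in> P" "q \<in> K" "q \<notin> M" for K q
    proof -
      have "P \<subseteq> K"
        by (rule subset_of_Int_maximal_subset[OF M P K(1) _ q]) (use PMQ K in blast)
      then have "P <+>\<^bsub>R\<^esub> I \<subseteq> K" using IQ K by (intro set_add_subset_left_ideal) auto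
      then show ?thesis unfolding top using left_ideal_subset[OF K(1)] by blast
    qed
    have PIM: "z \<in> M" if "z \<in> P" "z \<in> I" for z
    proof (rule ccontr)
      assume "z \<notin> M"
      then have "Q = carrier R" using fill[OF Q order_refl \<open>z \<in> P\<close>] IQ that by blast
      then have "P \<inter> M \<in> \<F>" unfolding \<F>_def Q_def using PM by blast
      then show False using minimal \<open>z \<notin> M\<close> that by blast
    qed
    have PQM: "q \<in> M" if "q \<in> P" "q \<in> Q" for q
    proof -
      from that obtain m x where mx: "m \<in> P" "m \<in> M" "x \<in> I" "q = m \<oplus> x"
        unfolding Q_def by (auto elim: mem_set_addE)
      have c: "m \<in> carrier R" "x \<in> carrier R" using mx P'(1) I'(1) by auto
      have "\<ominus> m \<oplus> q = x" using mx c by (simp add: a_assoc[symmetric] l_neg)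
      moreover have "\<ominus> m \<oplus> q \<in> P" using that mx P' by blast
      ultimately have "x \<in> M" using PIM mx by simp
      then show ?thesis using mx M' by simp
    qed
    have "maximal_left_ideal Q R"
    proof (intro maximal_left_ideal.intro maximal_left_ideal_axioms.intro Q)
      show "carrier R \<noteq> Q" using PQM False P'(1) by blast
      fix K assume K: "left_ideal K R" "Q \<subseteq> K"
      show "K = Q \<or> K = carrier R"
      proof (cases "K \<subseteq> Q")
        case False
        then obtain k where k: "k \<in> K" "k \<notin> Q" by blast
        then have "k \<in> P <+>\<^bsub>R\<^esub> I" unfolding top using left_ideal_subset[OF K(1)] by blast
        then obtain q x where qx: "q \<in> P" "x \<in> I" "k = q \<oplus> x" by (rule mem_set_addE)
        have c: "q \<in> carrier R" "x \<in> carrier R" using qx P'(1) I'(1) by auto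
        have "k \<oplus> \<ominus> x = q" using qx c by (simp add: a_assoc r_neg)
        moreover have "k \<oplus> \<ominus> x \<in> K"
          using k qx IQ K(2) left_ideal_add[OF K(1)] left_ideal_minus[OF K(1)] by blast
        ultimately have "q \<in> K" by simp
        moreover have "q \<notin> M"
          using k qx PMQ IQ left_ideal_add[OF Q] by blast
        ultimately show ?thesis using fill[OF K qx(1)] by blast
      qed (use K in blast)
    qed
    then have "p \<in> Q" using p(2) IQ unfolding jacobson_radical_def by blast
    then show ?thesis using PQM p by blast
  qed (use p in blast)
  fix a assume a: "a \<in> ?J"
  then have "a \<in> P <+>\<^bsub>R\<^esub> I" unfolding top using J'(1) by blast
  then obtain p x where px: "p \<in> P" "x \<in> I" "a = p \<oplus> x" by (rule mem_set_addE)
  have c: "p \<in> carrier R" "x \<in> carrier R" using px P'(1) I'(1) by auto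
  have "a \<oplus> \<ominus> x = p" using px c by (simp add: a_assoc r_neg)
  moreover have "a \<oplus> \<ominus> x \<in> ?J" using a px IJ J'(3,4) by blast
  ultimately have "p \<in> ?J" by simp
  then have "p \<in> jacobson_radical R {\<zero>}" using jacobson_radical_zeroI[OF c(1)] key px(1) by blast
  moreover have "a = x \<oplus> p" using px c by (simp add: a_comm)
  ultimately show "a \<in> I <+>\<^bsub>R\<^esub> jacobson_radical R {\<zero>}" using mem_set_addI[OF px(2)] by simp
qed

text \<open>The left ideals spanned by the \<open>n\<close>-fold products of elements of \<open>N\<close> become stationary at some
  \<open>B\<close>. If \<open>B\<close> were nonzero, there would be a minimal left ideal \<open>L\<close> with \<open>B L \<noteq> 0\<close>, and an \<open>x\<close> in it
  with \<open>B x \<noteq> 0\<close>. By minimality \<open>L = B x\<close>, so \<open>x = c x\<close> for some \<open>c \<in> B \<subseteq> N\<close>, which forces \<open>x = 0\<close>.\<close>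

lemma jacobson_radical_nilpotent:
  "\<exists>n\<ge>1. \<forall>ys. set ys \<subseteq> jacobson_radical R {\<zero>} \<longrightarrow> length ys = n \<longrightarrow> list_prod R ys = \<zero>"
proof -
  let ?N = "jacobson_radical R {\<zero>}"
  have N: "left_ideal ?N R" by (rule left_ideal_jacobson_radical)
  note N' = left_idealD[OF N]
  define prods where "prods n = {list_prod R ys | ys. set ys \<subseteq> ?N \<and> length ys = n}" for n
  define C where "C n = left_span (prods n)" for n
  have prods_carrier: "prods n \<subseteq> carrier R" for n
    unfolding prods_def using list_prod_closed N'(1) by blast
  have C: "left_ideal (C n) R" for n unfolding C_def by (rule left_ideal_left_span)
  have prods_C: "prods n \<subseteq> C n" for n
    unfolding C_def using prods_carrier by (rule left_span_superset)
  have prods_add: "\<exists>u\<in>prods m. \<exists>v\<in>prods n. z = u \<otimes> v" if z: "z \<in> prods (m + n)" for z m n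
  proof -
    from z obtain ys where ys: "z = list_prod R ys" "set ys \<subseteq> ?N" "length ys = m + n"
      unfolding prods_def by auto
    have sub: "set (take m ys) \<subseteq> ?N" "set (drop m ys) \<subseteq> ?N"
      using ys set_take_subset set_drop_subset by fast+
    have "z = list_prod R (take m ys) \<otimes> list_prod R (drop m ys)"
      using list_prod_append[of "take m ys" "drop m ys"] sub N'(1) ys(1) by auto
    moreover have "list_prod R (take m ys) \<in> prods m" "list_prod R (drop m ys) \<in> prods n"
      unfolding prods_def using sub ys(3) by force+
    ultimately show ?thesis by blast
  qed
  have "C (Suc n) \<subseteq> C n" for n
  proof -
    have "prods (Suc n) \<subseteq> C n"
    proof
      fix z assume "z \<in> prods (Suc n)"
      then obtain u v where "u \<in> prods 1" "v \<in> prods n" "z = u \<otimes> v"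
        using prods_add[of z 1 n] by auto
      then show "z \<in> C n" using prods_carrier prods_C left_ideal_mult[OF C] by blast
    qed
    then show ?thesis unfolding C_def[of "Suc n"] by (rule left_span_subset[OF C])
  qed
  then obtain k where k: "\<forall>n\<ge>k. C n = C k" using descending_chain[of C] C by blast
  \<comment> \<open>The exponent has to be positive, since the empty product \<open>1\<close> need not lie in \<open>N\<close>.\<close>
  define m where "m = Suc k"
  have stable: "C (m + m) = C m" using k[rule_format, of "m + m"] k[rule_format, of m]
    unfolding m_def by simp
  have "prods m \<subseteq> ?N"
  proof
    fix z assume "z \<in> prods m"
    then obtain ys where ys: "z = list_prod R ys" "set ys \<subseteq> ?N" "length ys = m"
      unfolding prods_def by blast
    then have "ys \<noteq> []" unfolding m_def by auto
    then show "z \<in> ?N" unfolding ys(1) by (rule list_prod_in_left_ideal[OF N ys(2)])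
  qed
  then have CN: "C m \<subseteq> ?N" unfolding C_def by (rule left_span_subset[OF N])
  note B' = left_idealD[OF C[of m]]
  have "prods m \<subseteq> {\<zero>}"
  proof (rule ccontr)
    assume nz: "\<not> prods m \<subseteq> {\<zero>}"
    have "\<not> prods (m + m) \<subseteq> {\<zero>}"
    proof
      assume "prods (m + m) \<subseteq> {\<zero>}"
      then have "C (m + m) \<subseteq> {\<zero>}" unfolding C_def by (rule left_span_subset[OF left_ideal_trivial])
      then show False using nz prods_C[of m] stable by blast
    qed
    then obtain u v where uv: "u \<in> C m" "v \<in> C m" "u \<otimes> v \<noteq> \<zero>"
      using prods_add[of _ m m] prods_C[of m] by blast
    define \<F> where "\<F> = {L. left_ideal L R \<and> (\<exists>b\<in>C m. \<exists>x\<in>L. b \<otimes> x \<noteq> \<zero>)}"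
    have "C m \<in> \<F>" unfolding \<F>_def using C uv by blast
    then have "\<exists>L\<in>\<F>. \<forall>K\<in>\<F>. \<not> K \<subset> L"
      by (intro exists_minimal_left_ideal) (auto simp: \<F>_def)
    then obtain L where "L \<in> \<F>" and minimal: "\<And>K. K \<in> \<F> \<Longrightarrow> \<not> K \<subset> L" by blast
    then obtain b x where L: "left_ideal L R" and b: "b \<in> C m" and x: "x \<in> L" and bx: "b \<otimes> x \<noteq> \<zero>"
      unfolding \<F>_def by blast
    have xc: "x \<in> carrier R" using x left_ideal_subset[OF L] by blast
    let ?Bx = "(\<lambda>c. c \<otimes> x) ` C m"
    have "?Bx \<in> \<F>"
    proof (rule ccontr)
      assume "?Bx \<notin> \<F>"
      then have kill: "c \<otimes> (d \<otimes> x) = \<zero>" if "c \<in> C m" "d \<in> C m" for c d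
        unfolding \<F>_def using left_ideal_times_elem[OF C xc] that by blast
      have "prods (m + m) \<subseteq> {r \<in> carrier R. r \<otimes> x = \<zero>}"
      proof
        fix z assume "z \<in> prods (m + m)"
        then obtain c d where cd: "c \<in> C m" "d \<in> C m" "z = c \<otimes> d"
          using prods_add[of z m m] prods_C[of m] by blast
        then have cdc: "c \<in> carrier R" "d \<in> carrier R" using B'(1) by auto
        then show "z \<in> {r \<in> carrier R. r \<otimes> x = \<zero>}" using kill[OF cd(1,2)] cd(3) xc
          by (simp add: m_assoc)
      qed
      then have "C (m + m) \<subseteq> {r \<in> carrier R. r \<otimes> x = \<zero>}"
        unfolding C_def by (rule left_span_subset[OF left_ideal_annihilator[OF xc]])
      then show False using b bx stable by blast
    qed
    moreover have "?Bx \<subseteq> L" using B'(1) left_ideal_mult[OF L] x by blast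
    ultimately have "?Bx = L" using minimal by blast
    then obtain c where "c \<in> C m" "x = c \<otimes> x" using x by blast
    then have "x = \<zero>" using eq_zero_of_jacobson_fixed[OF _ xc] CN by blast
    then show False using bx b B'(1) by auto
  qed
  then show ?thesis
    unfolding prods_def by (intro exI[of _ m]) (auto simp: m_def)
qed

lemma fully_integral_jacobson_radical:
  assumes I: "left_ideal I R"
  shows "fully_integral_over R I (jacobson_radical R I)"
proof -
  obtain n where n: "n \<ge> 1"
    and nil: "\<And>ys. set ys \<subseteq> jacobson_radical R {\<zero>} \<Longrightarrow> length ys = n \<Longrightarrow> list_prod R ys = \<zero>"
    using jacobson_radical_nilpotent by blast
  show ?thesis
    using fully_integral_of_nilpotent_decomposition[OF I
        left_ideal_subset[OF left_ideal_jacobson_radical] jacobson_radical_decomposition[OF I] n nil] .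
qed

lemma jacobson_radical_of_fully_integrally_closed:
  assumes "fully_integrally_closed R K"
  shows "jacobson_radical R K = K"
proof -
  have K: "left_ideal K R" using assms unfolding fully_integrally_closed_def by blast
  have "K \<subseteq> jacobson_radical R K" using left_ideal_subset[OF K] by (rule subset_jacobson_radical)
  then show ?thesis
    using assms left_ideal_jacobson_radical[of K] fully_integral_jacobson_radical[OF K]
    unfolding fully_integrally_closed_def by blast
qed

lemma jacobson_radical_subset_full_integral_radical:
  "jacobson_radical R I \<subseteq> full_integral_radical R I"
  unfolding full_integral_radical_def
  using jacobson_radical_mono jacobson_radical_of_fully_integrally_closed by blast

end

theorem theorem4p6:
  fixes R :: "('a, 'b) ring_scheme" and I :: "'a set"
  assumes "left_artinian_ring R" and "left_ideal I R"
  shows "left_ideal (jacobson_radical R I) R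
    \<and> fully_integral_over R I (jacobson_radical R I)
    \<and> full_integral_radical R I = integral_radical R I
    \<and> integral_radical R I = jacobson_radical R I"
proof -
  interpret left_artinian_ring R by fact
  have "jacobson_radical R I \<subseteq> full_integral_radical R I"
    by (rule jacobson_radical_subset_full_integral_radical)
  moreover have "full_integral_radical R I \<subseteq> integral_radical R I"
    by (rule full_integral_radical_subset_integral_radical)
  moreover have "integral_radical R I \<subseteq> jacobson_radical R I"
    using left_ideal_subset[OF assms(2)] by (rule integral_radical_subset_jacobson_radical)
  ultimately show ?thesis
    using left_ideal_jacobson_radical fully_integral_jacobson_radical[OF assms(2)] by blast
qed

end
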